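(* Let $\mathcal X$ be a separable normed space over $\mathbb F$ with $\dim\mathcal X>1$. If $T$ is a bounded linear operator on $\mathcal X$ that is power bounded and weakly l-sequentially supercyclic, then $T$ is weakly quasistable; that is, $\liminf_n|f(T^nx)|=0$ for every $x\in\mathcal X$ and every $f\in\mathcal X^*$.
   Context: $\mathbb F$ is $\mathbb R$ or $\mathbb C$; $\mathcal X^*$ is the (topological) dual of the normed space $\mathcal X$ (not assumed complete). A bounded linear operator $T:\mathcal X\to\mathcal X$ is power bounded if $\sup_{n\ge0}\|T^n\|<\infty$. It is weakly quasistable if $\liminf_n|f(T^nx)|=0$ for every $x\in\mathcal X$ and every $f\in\mathcal X^*$. The projective orbit of a nonzero vector $y$ under $T$ is $\mathcal O_T([y])=\{\alpha T^ny:\alpha\in\mathbb F,\ n\ge0 \text{ an integer}\}$. The weak limit set $A^{-wl}$ of $A\subseteq\mathcal X$ is the set of all weak limits of weakly convergent $A$-valued sequences. A nonzero $y\in\mathcal X$ is a weakly l-sequentially supercyclic vector for $T$ if $\mathcal O_T([y])^{-wl}=\mathcal X$, i.e., for every $x\in\mathcal X$ there are scalars $\alpha_k$ and nonnegative integers $n_k$ such that $\alpha_kT^{n_k}y\to x$ weakly. $T$ is a weakly l-sequentially supercyclic operator if it has such a vector. *)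

theory Defs
  imports "HOL-Analysis.Analysis" "HOL-Library.Extended_Nat"
begin

text \<open>
  The scalar field is \<open>\<real>\<close> or \<open>\<complex>\<close>, up to isometric isomorphism: either every scalar is a real
  multiple of 1, or the scalars are the numbers \<open>a + b i\<close> with \<open>i\<^sup>2 = -1\<close> and the Euclidean modulus.
\<close>

class real_or_complex_field = real_normed_field +
  assumes real_or_complex:
    "(\<forall>z. \<exists>a. z = a *\<^sub>R 1) \<or>
     (\<exists>i. i * i = - 1 \<and>
          (\<forall>z. \<exists>a b. z = a *\<^sub>R 1 + b *\<^sub>R i) \<and>
          (\<forall>a b. norm (a *\<^sub>R 1 + b *\<^sub>R i) = sqrt (a\<^sup>2 + b\<^sup>2)))"

instance real :: real_or_complex_field
  by standard auto

instance complex :: real_or_complex_field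
proof
  have "\<i> * \<i> = - 1 \<and>
        (\<forall>z. \<exists>a b. z = a *\<^sub>R 1 + b *\<^sub>R \<i>) \<and>
        (\<forall>a b. norm (a *\<^sub>R 1 + b *\<^sub>R \<i>) = sqrt (a\<^sup>2 + b\<^sup>2))"
    by (auto simp: complex_eq_iff cmod_def)
  then show "(\<forall>z::complex. \<exists>a. z = a *\<^sub>R 1) \<or>
     (\<exists>i::complex. i * i = - 1 \<and>
          (\<forall>z. \<exists>a b. z = a *\<^sub>R 1 + b *\<^sub>R i) \<and>
          (\<forall>a b. norm (a *\<^sub>R 1 + b *\<^sub>R i) = sqrt (a\<^sup>2 + b\<^sup>2)))"
    by blast
qed

text \<open>
  A normed space over such a field is a real normed space (whose norm and topology are those of the
  type class) with a multiplication by scalars that extends the real one. The type is not assumed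
  to be complete.
\<close>

locale normed_space_over = vector_space scl
  for scl :: "'f::real_or_complex_field \<Rightarrow> 'a::real_normed_vector \<Rightarrow> 'a" +
  assumes scale_of_real: "scl (of_real r) x = r *\<^sub>R x"
    and norm_scale: "norm (scl c x) = norm c * norm x"

lemma normed_space_over_scaleR:
  "normed_space_over (scaleR :: real \<Rightarrow> 'a::real_normed_vector \<Rightarrow> 'a)"
  by unfold_locales (auto simp: algebra_simps)

lemma normed_space_over_mult:
  "normed_space_over ((*) :: 'f \<Rightarrow> 'f::real_or_complex_field \<Rightarrow> 'f)"
  by unfold_locales (auto simp: algebra_simps norm_mult scaleR_conv_of_real)

text \<open>The library's \<^term>\<open>vector_space.dim\<close> is 0 on infinite-dimensional spaces.\<close>

definition edim :: "('f::field \<Rightarrow> 'a::ab_group_add \<Rightarrow> 'a) \<Rightarrow> enat" where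
  "edim scl =
     (if \<exists>B. finite B \<and> module.span scl B = UNIV
      then enat (vector_space.dim scl UNIV) else \<infinity>)"

text \<open>\<^term>\<open>bounded_linear\<close> alone would only require linearity over the reals.\<close>

definition bounded_linear_operator ::
    "('f::real_or_complex_field \<Rightarrow> 'a::real_normed_vector \<Rightarrow> 'a) \<Rightarrow> ('a \<Rightarrow> 'a) \<Rightarrow> bool" where
  "bounded_linear_operator scl T \<longleftrightarrow>
     Vector_Spaces.linear scl scl T \<and> bounded_linear T"

definition dual_space ::
    "('f::real_or_complex_field \<Rightarrow> 'a::real_normed_vector \<Rightarrow> 'a) \<Rightarrow> ('a \<Rightarrow> 'f) set" where
  "dual_space scl = {f. Vector_Spaces.linear scl (*) f \<and> bounded_linear f}"

definition power_bounded :: "('a::real_normed_vector \<Rightarrow> 'a) \<Rightarrow> bool" where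
  "power_bounded T \<longleftrightarrow> bdd_above (range (\<lambda>n. onorm (T ^^ n)))"

definition weakly_quasistable ::
    "('f::real_or_complex_field \<Rightarrow> 'a::real_normed_vector \<Rightarrow> 'a) \<Rightarrow> ('a \<Rightarrow> 'a) \<Rightarrow> bool" where
  "weakly_quasistable scl T \<longleftrightarrow>
     (\<forall>x. \<forall>f\<in>dual_space scl. liminf (\<lambda>n. ereal (norm (f ((T ^^ n) x)))) = 0)"

definition weakly_tendsto ::
    "('f::real_or_complex_field \<Rightarrow> 'a::real_normed_vector \<Rightarrow> 'a) \<Rightarrow> (nat \<Rightarrow> 'a) \<Rightarrow> 'a \<Rightarrow> bool" where
  "weakly_tendsto scl u x \<longleftrightarrow> (\<forall>f\<in>dual_space scl. (\<lambda>k. f (u k)) \<longlonglongrightarrow> f x)"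

definition weak_limit_set ::
    "('f::real_or_complex_field \<Rightarrow> 'a::real_normed_vector \<Rightarrow> 'a) \<Rightarrow> 'a set \<Rightarrow> 'a set" where
  "weak_limit_set scl A = {x. \<exists>u. range u \<subseteq> A \<and> weakly_tendsto scl u x}"

definition projective_orbit ::
    "('f \<Rightarrow> 'a \<Rightarrow> 'a) \<Rightarrow> ('a \<Rightarrow> 'a) \<Rightarrow> 'a \<Rightarrow> 'a set" where
  "projective_orbit scl T y = {scl \<alpha> ((T ^^ n) y) |\<alpha> n. True}"

definition weakly_l_sequentially_supercyclic_vector ::
    "('f::real_or_complex_field \<Rightarrow> 'a::real_normed_vector \<Rightarrow> 'a) \<Rightarrow> ('a \<Rightarrow> 'a) \<Rightarrow> 'a \<Rightarrow> bool" where
  "weakly_l_sequentially_supercyclic_vector scl T y \<longleftrightarrow>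
     y \<noteq> 0 \<and> weak_limit_set scl (projective_orbit scl T y) = UNIV"

definition weakly_l_sequentially_supercyclic ::
    "('f::real_or_complex_field \<Rightarrow> 'a::real_normed_vector \<Rightarrow> 'a) \<Rightarrow> ('a \<Rightarrow> 'a) \<Rightarrow> bool" where
  "weakly_l_sequentially_supercyclic scl T \<longleftrightarrow>
     (\<exists>y. weakly_l_sequentially_supercyclic_vector scl T y)"

end

(*
  Suppose |f(T^n x)| is bounded away from 0. By Hahn-Banach the span of the orbit of the supercyclic
  vector y is norm dense, so, T being power bounded, x may be taken in this span. Let
  P = T - c I with c chosen such that f(P x) = 0, and let a_k T^(n_k) y tend weakly to P y. Then
  a_k T^(n_k) x tends weakly to P x, hence a_k f(T^(n_k) x) -> 0 and therefore a_k -> 0. By power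
  boundedness P y = 0, so y is an eigenvector of T and the space is one-dimensional.
*)

theory Submission
  imports Defs
begin

section \<open>Sublinear functionals\<close>

text \<open>For \<open>r = 0\<close> and by inversion of \<open>r\<close>, homogeneity follows from the inequality.\<close>

definition sublinear_functional :: "('a::real_vector \<Rightarrow> real) \<Rightarrow> bool" where
  "sublinear_functional p \<longleftrightarrow>
     (\<forall>x y. p (x + y) \<le> p x + p y) \<and> (\<forall>r\<ge>0. \<forall>x. p (r *\<^sub>R x) \<le> r * p x)"

lemma sublinear_functional_add: "sublinear_functional p \<Longrightarrow> p (x + y) \<le> p x + p y"
  by (simp add: sublinear_functional_def)

lemma sublinear_functional_scaleR_le:
  "sublinear_functional p \<Longrightarrow> r \<ge> 0 \<Longrightarrow> p (r *\<^sub>R x) \<le> r * p x"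
  by (simp add: sublinear_functional_def)

lemma sublinear_functional_zero:
  assumes "sublinear_functional p"
  shows "p 0 = 0"
  using sublinear_functional_add[OF assms, of 0 0] sublinear_functional_scaleR_le[OF assms, of 0 0]
  by simp

lemma sublinear_functional_scaleR:
  assumes "sublinear_functional p" "r \<ge> 0"
  shows "p (r *\<^sub>R x) = r * p x"
proof (cases "r = 0")
  case True
  then show ?thesis using sublinear_functional_zero[OF assms(1)] by simp
next
  case False
  with assms(2) have r: "r > 0" by simp
  have "p x \<le> inverse r * p (r *\<^sub>R x)"
    using sublinear_functional_scaleR_le[OF assms(1), of "inverse r" "r *\<^sub>R x"] r by simp
  then have "r * p x \<le> p (r *\<^sub>R x)" using r by (simp add: field_simps)
  with sublinear_functional_scaleR_le[OF assms, of x] show ?thesis by simp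
qed

lemma sublinear_functional_minus:
  assumes "sublinear_functional p"
  shows "- p (- x) \<le> p x"
  using sublinear_functional_add[OF assms, of x "- x"] sublinear_functional_zero[OF assms] by simp

text \<open>In a chain the smaller of two functionals lies below both, which makes the infimum
  subadditive. This supplies the lower bounds for Zorn's lemma.\<close>

lemma sublinear_functional_INF:
  assumes "C \<noteq> {}" and sub: "\<And>p. p \<in> C \<Longrightarrow> sublinear_functional p"
    and tot: "\<And>p q. p \<in> C \<Longrightarrow> q \<in> C \<Longrightarrow> p \<le> q \<or> q \<le> p"
    and bdd: "\<And>x. bdd_below ((\<lambda>p. p x) ` C)"
  shows "sublinear_functional (\<lambda>x. INF p\<in>C. p x)" (is "sublinear_functional ?u")
proof -
  have le: "?u x \<le> p x" if "p \<in> C" for p x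
    using bdd that by (rule cINF_lower)
  have "?u (x + y) \<le> ?u x + ?u y" for x y
  proof -
    have *: "?u (x + y) \<le> p x + q y" if pq: "p \<in> C" "q \<in> C" for p q
    proof -
      obtain e where e: "e \<in> C" "e \<le> p" "e \<le> q" using tot[OF pq] pq by blast
      have "?u (x + y) \<le> e (x + y)" using e le by blast
      also have "\<dots> \<le> e x + e y" using sublinear_functional_add sub e by blast
      also have "\<dots> \<le> p x + q y" using e by (simp add: add_mono le_funD)
      finally show ?thesis .
    qed
    \<comment> \<open>The double infimum is taken one variable at a time: over the second functional
      with \<open>p\<close> fixed, then over \<open>p\<close>.\<close>
    have "?u (x + y) - p x \<le> ?u y" if "p \<in> C" for p
      using *[OF that] by (intro cINF_greatest[OF \<open>C \<noteq> {}\<close>]) (simp add: algebra_simps)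
    then have "?u (x + y) - ?u y \<le> ?u x"
      by (intro cINF_greatest[OF \<open>C \<noteq> {}\<close>]) (simp add: algebra_simps)
    then show ?thesis by simp
  qed
  moreover have "?u (r *\<^sub>R x) \<le> r * ?u x" if r: "r \<ge> 0" for r x
  proof (cases "r = 0")
    case True
    have "?u 0 = (INF p\<in>C. 0)" by (rule INF_cong) (use sublinear_functional_zero sub in auto)
    then have "?u 0 = 0" using \<open>C \<noteq> {}\<close> by simp
    then show ?thesis using True by simp
  next
    case False
    with r have r: "r > 0" by simp
    have "?u (r *\<^sub>R x) / r \<le> p x" if "p \<in> C" for p
    proof -
      have "?u (r *\<^sub>R x) \<le> p (r *\<^sub>R x)" using le that .
      also have "\<dots> \<le> r * p x" using sublinear_functional_scaleR_le[OF sub[OF that]] r by simp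
      finally show ?thesis using r by (simp add: field_simps)
    qed
    then have "?u (r *\<^sub>R x) / r \<le> ?u x" by (rule cINF_greatest[OF \<open>C \<noteq> {}\<close>])
    then show ?thesis using r by (simp add: field_simps)
  qed
  ultimately show ?thesis by (simp add: sublinear_functional_def)
qed

text \<open>The functional \<open>q\<close> is the infimum of
  \<open>p (v + t *\<^sub>R x) - t * p x\<close> over \<open>t \<ge> 0\<close>: \<open>t = 0\<close>
  shows \<open>q \<le> p\<close>, and \<open>t = 1\<close> gives the bound at \<open>- x\<close>. If
  \<open>p\<close> is minimal, then \<open>q = p\<close>, which forces \<open>p\<close> to be
  odd.\<close>

lemma sublinear_functional_reduce:
  assumes p: "sublinear_functional p"
  obtains q where "sublinear_functional q" "q \<le> p" "q (- x) \<le> - p x"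
proof
  let ?h = "\<lambda>v t. p (v + t *\<^sub>R x) - t * p x"
  let ?q = "\<lambda>v. INF t\<in>{0..}. ?h v t"
  have ne: "{0::real..} \<noteq> {}" by auto
  \<comment> \<open>Subadditivity applied to
    \<open>t *\<^sub>R x = (v + t *\<^sub>R x) + (- v)\<close> gives a lower bound independent of
    \<open>t\<close>, so the infimum is a genuine one.\<close>
  have "- p (- v) \<le> ?h v t" if "t \<ge> 0" for v t
    using sublinear_functional_add[OF p, of "v + t *\<^sub>R x" "- v"]
      sublinear_functional_scaleR[OF p that, of x] by simp
  then have bdd: "bdd_below (?h v ` {0..})" for v
    by (intro bdd_belowI[of _ "- p (- v)"]) auto
  have le: "?q v \<le> ?h v t" if "t \<ge> 0" for v t
    using bdd that by (intro cINF_lower) auto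
  show "?q \<le> p" using le[of 0] by (simp add: le_fun_def)
  show "?q (- x) \<le> - p x" using le[of 1 "- x"] sublinear_functional_zero[OF p] by simp
  have "?q (v + w) \<le> ?q v + ?q w" for v w
  proof -
    \<comment> \<open>The parameter \<open>s + t\<close> for \<open>v + w\<close> splits into
      \<open>s\<close> for \<open>v\<close> and \<open>t\<close> for \<open>w\<close>.\<close>
    have *: "?q (v + w) \<le> ?h v s + ?h w t" if "s \<ge> 0" "t \<ge> 0" for s t
      using le[of "s + t" "v + w"] that
        sublinear_functional_add[OF p, of "v + s *\<^sub>R x" "w + t *\<^sub>R x"]
      by (simp add: algebra_simps)
    have "?q (v + w) - ?h v s \<le> ?q w" if "s \<ge> 0" for s
      using *[OF that] by (intro cINF_greatest[OF ne]) (simp add: algebra_simps)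
    then have "?q (v + w) - ?q w \<le> ?q v"
      by (intro cINF_greatest[OF ne]) (simp add: algebra_simps)
    then show ?thesis by simp
  qed
  moreover have "?q (r *\<^sub>R v) \<le> r * ?q v" if r: "r \<ge> 0" for r v
  proof (cases "r = 0")
    case True
    then show ?thesis using le[of 0 0] sublinear_functional_zero[OF p] by simp
  next
    case False
    with r have r: "r > 0" by simp
    have "?q (r *\<^sub>R v) / r \<le> ?h v t" if "t \<ge> 0" for t
    proof -
      \<comment> \<open>Rescaling the parameter to \<open>r * t\<close> lets the factor
        \<open>r\<close> be taken out of \<open>p\<close>.\<close>
      have "?q (r *\<^sub>R v) \<le> p (r *\<^sub>R (v + t *\<^sub>R x)) - r * t * p x"
        using le[of "r * t" "r *\<^sub>R v"] r that by (simp add: scaleR_add_right)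
      also have "\<dots> = r * ?h v t"
        using sublinear_functional_scaleR[OF p, of r "v + t *\<^sub>R x"] r
        by (simp add: right_diff_distrib)
      finally show ?thesis using r by (simp add: field_simps)
    qed
    then have "?q (r *\<^sub>R v) / r \<le> ?q v" by (intro cINF_greatest[OF ne]) auto
    then show ?thesis using r by (simp add: field_simps)
  qed
  ultimately show "sublinear_functional ?q" by (simp add: sublinear_functional_def)
qed

section \<open>The Hahn-Banach theorem by minimal sublinear functionals\<close>

text \<open>Zorn's lemma yields a minimal sublinear functional below \<open>p\<close>. As
  \<open>sublinear_functional_reduce\<close> cannot lower it any further, it is odd, and an odd
  sublinear functional is linear.\<close>

lemma linear_below_sublinear_functional:
  assumes p: "sublinear_functional p"
  obtains u where "linear u" "u \<le> p"
proof -
  define A where "A = {q. sublinear_functional q \<and> q \<le> p}"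
  \<comment> \<open>The order is reversed, so that the maximal element from Zorn's lemma is a
    minimal functional.\<close>
  let ?P = "\<lambda>f g :: 'a \<Rightarrow> real. g \<le> f"
  have "\<exists>m\<in>A. \<forall>a\<in>A. ?P m a \<longrightarrow> a = m"
  proof (rule predicate_Zorn)
    show "partial_order_on A (relation_of ?P A)"
      by (rule partial_order_on_relation_ofI) auto
  next
    fix C assume C: "C \<in> Chains (relation_of ?P A)"
    show "\<exists>u\<in>A. \<forall>a\<in>C. ?P a u"
    proof (cases "C = {}")
      case True
      then show ?thesis using p by (auto simp: A_def)
    next
      case False
      have tot: "f \<le> g \<or> g \<le> f" if "f \<in> C" "g \<in> C" for f g
        using C that by (auto simp: Chains_def relation_of_def)
      have CA: "q \<in> A" if "q \<in> C" for q
        using C that by (auto simp: Chains_def relation_of_def)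
      \<comment> \<open>Every member of the chain lies below \<open>p\<close>, so
        \<open>- p (- x) \<le> - q (- x) \<le> q x\<close> bounds the whole chain from
        below.\<close>
      have "- p (- x) \<le> q x" if "q \<in> C" for q x
        using CA[OF that] sublinear_functional_minus[of q x]
        by (force simp: A_def le_fun_def intro: order_trans[of _ "- q (- x)"])
      then have bdd: "bdd_below ((\<lambda>q. q x) ` C)" for x
        by (intro bdd_belowI[of _ "- p (- x)"]) auto
      let ?u = "\<lambda>x. INF q\<in>C. q x"
      have le: "?u \<le> q" if "q \<in> C" for q
        using bdd that by (auto simp: le_fun_def intro: cINF_lower)
      have "sublinear_functional ?u"
        using False CA tot bdd by (intro sublinear_functional_INF) (auto simp: A_def)
      moreover have "?u \<le> p"
        using False CA le by (force simp: A_def intro: order_trans)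
      ultimately show ?thesis using le by (auto simp: A_def)
    qed
  qed
  then obtain u where u: "u \<in> A" and min: "\<And>q. q \<in> A \<Longrightarrow> q \<le> u \<Longrightarrow> q = u" by blast
  have su: "sublinear_functional u" and "u \<le> p" using u by (auto simp: A_def)
  have minus: "u (- x) = - u x" for x
  proof -
    obtain q where q: "sublinear_functional q" "q \<le> u" "q (- x) \<le> - u x"
      using sublinear_functional_reduce[OF su] .
    then have "q = u" using min \<open>u \<le> p\<close> by (auto simp: A_def)
    then show ?thesis using q sublinear_functional_minus[OF su, of x] by simp
  qed
  have "linear u"
  proof (rule linearI)
    \<comment> \<open>By oddness, subadditivity at \<open>- x\<close> and \<open>- y\<close> is the
      reverse inequality.\<close>
    show "u (x + y) = u x + u y" for x y
      using sublinear_functional_add[OF su, of x y] sublinear_functional_add[OF su, of "- x" "- y"]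
        minus[of x] minus[of y] minus[of "x + y"] by simp
    show "u (r *\<^sub>R x) = r *\<^sub>R u x" for r x
    proof (cases "r \<ge> 0")
      case True
      then show ?thesis using sublinear_functional_scaleR[OF su] by simp
    next
      case False
      then show ?thesis
        using sublinear_functional_scaleR[OF su, of "- r" x] minus[of "r *\<^sub>R x"] by simp
    qed
  qed
  then show ?thesis using that \<open>u \<le> p\<close> by blast
qed

section \<open>Separation from a real subspace by the distance function\<close>

lemma sublinear_functional_infdist:
  fixes S :: "'a::real_normed_vector set"
  assumes S: "subspace S"
  shows "sublinear_functional (\<lambda>x. infdist x S)"
proof -
  have ne: "S \<noteq> {}" using subspace_0[OF S] by auto
  have id: "infdist x S = (INF s\<in>S. dist x s)" for x using infdist_notempty[OF ne] .
  have "infdist (x + y) S \<le> infdist x S + infdist y S" for x y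
  proof -
    have *: "infdist (x + y) S \<le> dist x s + dist y t" if "s \<in> S" "t \<in> S" for s t
      using infdist_le[OF subspace_add[OF S that], of "x + y"] dist_triangle_add[of x y s t] by simp
    have "infdist (x + y) S - dist x s \<le> infdist y S" if "s \<in> S" for s
      unfolding id[of y] using *[OF that] by (intro cINF_greatest[OF ne]) (simp add: algebra_simps)
    then have "infdist (x + y) S - infdist y S \<le> infdist x S"
      unfolding id[of x] by (intro cINF_greatest[OF ne]) (simp add: algebra_simps)
    then show ?thesis by simp
  qed
  moreover have "infdist (r *\<^sub>R x) S \<le> r * infdist x S" if r: "r \<ge> 0" for r x
  proof (cases "r = 0")
    case True
    then show ?thesis using subspace_0[OF S] by simp
  next
    case False
    with r have r: "r > 0" by simp
    have "infdist (r *\<^sub>R x) S / r \<le> dist x s" if "s \<in> S" for s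
    proof -
      have "infdist (r *\<^sub>R x) S \<le> dist (r *\<^sub>R x) (r *\<^sub>R s)"
        using infdist_le[OF subspace_scale[OF S that]] .
      also have "\<dots> = r * dist x s" using r by (simp add: dist_norm flip: scaleR_diff_right)
      finally show ?thesis using r by (simp add: field_simps)
    qed
    then have "infdist (r *\<^sub>R x) S / r \<le> infdist x S"
      unfolding id[of x] by (rule cINF_greatest[OF ne])
    then show ?thesis using r by (simp add: field_simps)
  qed
  ultimately show ?thesis by (simp add: sublinear_functional_def)
qed

text \<open>Lowering the distance to \<open>S\<close> at \<open>x\<close> before taking a linear
  minorant \<open>u\<close> forces \<open>u x\<close> to be at least the distance of
  \<open>x\<close>. The distance vanishes on \<open>S\<close> and is at most the norm, so
  \<open>u\<close> vanishes on \<open>S\<close> and is bounded.\<close>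

lemma separate_point_from_subspace:
  fixes S :: "'a::real_normed_vector set"
  assumes S: "subspace S" and x: "x \<notin> closure S"
  obtains u :: "'a \<Rightarrow> real" where "bounded_linear u" "\<And>s. s \<in> S \<Longrightarrow> u s = 0" "u x > 0"
proof -
  let ?d = "\<lambda>x. infdist x S"
  have ne: "S \<noteq> {}" using subspace_0[OF S] by auto
  obtain q where q: "sublinear_functional q" "q \<le> ?d" "q (- x) \<le> - ?d x"
    using sublinear_functional_reduce[OF sublinear_functional_infdist[OF S]] .
  obtain u where u: "linear u" "u \<le> q" using linear_below_sublinear_functional[OF q(1)] .
  have ud: "u v \<le> ?d v" for v using u(2) q(2) by (meson le_funD order_trans)
  have minus: "u (- v) = - u v" for v using linear_neg[OF u(1)] .
  have "u s = 0" if "s \<in> S" for s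
    using ud[of s] ud[of "- s"] that subspace_neg[OF S that] minus[of s] by simp
  moreover have "u x > 0"
  proof -
    have "?d x > 0"
      using x in_closure_iff_infdist_zero[OF ne] infdist_nonneg[of x S] by fastforce
    then show ?thesis using le_funD[OF u(2), of "- x"] q(3) minus[of x] by simp
  qed
  moreover have "bounded_linear u"
  proof (rule bounded_linear_intro[where K = 1])
    show "u (v + w) = u v + u w" for v w using linear_add[OF u(1)] .
    show "u (r *\<^sub>R v) = r *\<^sub>R u v" for r v using linear_scale[OF u(1)] .
    have "?d v \<le> norm v" for v using infdist_le[OF subspace_0[OF S], of v] by simp
    then have "u v \<le> norm v" for v using ud order_trans by blast
    then show "norm (u v) \<le> norm v * 1" for v
      using minus[of v] by (metis abs_le_iff mult.right_neutral norm_minus_cancel real_norm_def)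
  qed
  ultimately show ?thesis using that by blast
qed

section \<open>Dual space, operators and separation over the scalar field\<close>

context normed_space_over
begin

text \<open>Real homogeneity is the case of scalars \<open>of_real r\<close>, so homogeneity over
  the field also yields \<open>bounded_linear\<close>.\<close>

lemma dual_spaceI:
  assumes "\<And>x y. f (x + y) = f x + f y" "\<And>c x. f (scl c x) = c * f x"
    "\<And>x. norm (f x) \<le> norm x * K"
  shows "f \<in> dual_space scl"
proof -
  have "f (r *\<^sub>R x) = r *\<^sub>R f x" for r x
    using assms(2)[of "of_real r" x] by (simp add: scale_of_real scaleR_conv_of_real)
  then have "bounded_linear f" using assms by (intro bounded_linear_intro) auto
  moreover have "Vector_Spaces.linear scl (*) f"
    unfolding Vector_Spaces.linear_iff
    using assms vector_space_axioms normed_space_over.axioms(1)[OF normed_space_over_mult]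
    by blast
  ultimately show ?thesis by (simp add: dual_space_def)
qed

lemma dual_space_add: "f \<in> dual_space scl \<Longrightarrow> f (x + y) = f x + f y"
  by (simp add: dual_space_def Vector_Spaces.linear_iff)

lemma dual_space_scale: "f \<in> dual_space scl \<Longrightarrow> f (scl c x) = c * f x"
  by (simp add: dual_space_def Vector_Spaces.linear_iff)

lemma dual_space_zero: "f \<in> dual_space scl \<Longrightarrow> f 0 = 0"
  using dual_space_scale[of f 0 0] by simp

lemma dual_space_diff: "f \<in> dual_space scl \<Longrightarrow> f (x - y) = f x - f y"
  using dual_space_add[of f "x - y" y] by simp

lemma bounded_linear_operator_add:
  "bounded_linear_operator scl T \<Longrightarrow> T (x + y) = T x + T y"
  by (simp add: bounded_linear_operator_def Vector_Spaces.linear_iff)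

lemma bounded_linear_operator_scale:
  "bounded_linear_operator scl T \<Longrightarrow> T (scl c x) = scl c (T x)"
  by (simp add: bounded_linear_operator_def Vector_Spaces.linear_iff)

lemma bounded_linear_operator_funpow:
  assumes "bounded_linear_operator scl T"
  shows "bounded_linear_operator scl (T ^^ n)"
proof (induction n)
  case 0
  then show ?case
    using vector_space_axioms bounded_linear_ident
    by (auto simp: bounded_linear_operator_def Vector_Spaces.linear_iff id_def)
next
  case (Suc n)
  then show ?case
    using assms bounded_linear_compose[of T "T ^^ n"]
    by (auto simp: bounded_linear_operator_def Vector_Spaces.linear_iff comp_def)
qed

lemma dual_space_comp:
  assumes "f \<in> dual_space scl" "bounded_linear_operator scl T"
  shows "(\<lambda>x. f (T x)) \<in> dual_space scl"
  using assms bounded_linear_compose[of f T]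
  by (auto simp: dual_space_def bounded_linear_operator_def Vector_Spaces.linear_iff)

text \<open>In the complex case a real functional \<open>u\<close> gives the complex functional \<open>u(x) - i u(ix)\<close>.\<close>

lemma dual_space_separates_subspace:
  assumes S: "subspace S" and x: "x \<notin> closure S"
  obtains f where "f \<in> dual_space scl" "\<And>s. s \<in> S \<Longrightarrow> f s = 0" "f x \<noteq> 0"
proof -
  \<comment> \<open>Here \<open>subspace\<close> refers to \<open>scl\<close>; real scalars act
    through \<open>of_real\<close>, so \<open>S\<close> is a real subspace too.\<close>
  have scS: "r *\<^sub>R s \<in> S" if "s \<in> S" for r s
    using subspace_scale[OF S that, of "of_real r"] by (simp add: scale_of_real)
  have "real_vector.subspace S"
    using subspace_0[OF S] subspace_add[OF S] scS by (auto simp: real_vector.subspace_def)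
  then obtain u :: "'a \<Rightarrow> real"
    where u: "bounded_linear u" "\<And>s. s \<in> S \<Longrightarrow> u s = 0" "u x > 0"
    using separate_point_from_subspace x by blast
  obtain K where K: "\<And>v. norm (u v) \<le> norm v * K" using bounded_linear.bounded[OF u(1)] by blast
  have u_add: "u (v + w) = u v + u w" and u_sc: "u (r *\<^sub>R v) = r * u v" for v w r
    using linear_add linear_scale bounded_linear.linear[OF u(1)] by fastforce+
  from real_or_complex[where 'a = 'f] show ?thesis
  proof
    assume R: "\<forall>z::'f. \<exists>a. z = a *\<^sub>R 1"
    let ?f = "\<lambda>v. of_real (u v) :: 'f"
    have "?f \<in> dual_space scl"
    proof (rule dual_spaceI)
      show "?f (scl c v) = c * ?f v" for c v
      proof -
        obtain a where "c = of_real a" using R by (metis of_real_def)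
        then show ?thesis by (simp add: scale_of_real u_sc)
      qed
    qed (use K u_add in auto)
    then show ?thesis using u by (intro that[of ?f]) auto
  next
    assume "\<exists>i::'f. i * i = - 1 \<and> (\<forall>z. \<exists>a b. z = a *\<^sub>R 1 + b *\<^sub>R i) \<and>
          (\<forall>a b. norm (a *\<^sub>R 1 + b *\<^sub>R i) = sqrt (a\<^sup>2 + b\<^sup>2))"
    then obtain i :: 'f where i: "i * i = - 1" and dec: "\<And>z. \<exists>a b. z = of_real a + of_real b * i"
      and nrm: "\<And>a b. norm (of_real a + of_real b * i) = sqrt (a\<^sup>2 + b\<^sup>2)"
      by (metis of_real_def scaleR_conv_of_real)
    let ?f = "\<lambda>v. of_real (u v) - of_real (u (scl i v)) * i"
    have ni: "norm i = 1" using nrm[of 0 1] by simp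
    have ii: "scl i (scl i v) = (- 1) *\<^sub>R v" for v
      using i scale_of_real[of "-1" v] by simp
    have "?f \<in> dual_space scl"
    proof (rule dual_spaceI)
      show "?f (v + w) = ?f v + ?f w" for v w
        by (simp add: u_add scale_right_distrib algebra_simps)
      show "?f (scl c v) = c * ?f v" for c v
      proof -
        obtain a b where c: "c = of_real a + of_real b * i" using dec by blast
        have cv: "scl c v = a *\<^sub>R v + b *\<^sub>R scl i v"
          unfolding c scale_left_distrib
          by (simp add: scale_of_real flip: scale_scale)
        have icv: "scl i (scl c v) = a *\<^sub>R scl i v + (- b) *\<^sub>R v"
        proof -
          have "scl i (scl c v) = scl c (scl i v)" by (simp add: mult.commute)
          also have "\<dots> = a *\<^sub>R scl i v + b *\<^sub>R scl i (scl i v)"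
            unfolding c scale_left_distrib by (simp add: scale_of_real flip: scale_scale)
          finally show ?thesis by (simp only: ii) simp
        qed
        have "c * ?f v = of_real (a * u v) - of_real (a * u (scl i v)) * i
            + of_real (b * u v) * i - of_real (b * u (scl i v)) * (i * i)"
          unfolding c by (simp add: algebra_simps)
        also have "\<dots> = ?f (scl c v)"
          unfolding icv unfolding cv u_add u_sc i by (simp add: algebra_simps)
        finally show ?thesis ..
      qed
      show "norm (?f v) \<le> norm v * (2 * K)" for v
      proof -
        have "norm (?f v) \<le> norm (u v) + norm (u (scl i v))"
          using norm_triangle_ineq4[of "of_real (u v)" "of_real (u (scl i v)) * i"]
          by (simp add: norm_mult ni)
        also have "\<dots> \<le> norm v * K + norm (scl i v) * K" using K add_mono by blast
        finally show ?thesis by (simp add: norm_scale ni algebra_simps)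
      qed
    qed
    \<comment> \<open>Since \<open>S\<close> is closed under multiplication by \<open>i\<close>,
      both parts of \<open>?f\<close> vanish on it.\<close>
    moreover have "?f s = 0" if "s \<in> S" for s
      using u(2) that subspace_scale[OF S that] by simp
    \<comment> \<open>The modulus of \<open>?f x\<close> is the Euclidean norm of the pair
      \<open>u x\<close>, \<open>- u (scl i x)\<close>, whose first entry is positive.\<close>
    moreover have "?f x \<noteq> 0"
      using nrm[of "u x" "- u (scl i x)"] u(3) by (auto simp: sum_power2_eq_zero_iff)
    ultimately show ?thesis using that by blast
  qed
qed

text \<open>A nonzero vector lies outside the closed subspace \<open>{0}\<close> and is separated
  from it.\<close>

lemma dual_space_eq_zeroI:
  assumes "\<And>f. f \<in> dual_space scl \<Longrightarrow> f x = 0"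
  shows "x = 0"
proof (rule ccontr)
  assume "x \<noteq> 0"
  then show False
    using dual_space_separates_subspace[of "{0}" x] assms by (auto simp: subspace_def)
qed

text \<open>A separating functional would vanish along the whole sequence but not at its weak
  limit.\<close>

lemma weakly_tendsto_in_closure:
  assumes S: "subspace S" and u: "\<And>k. u k \<in> S" "weakly_tendsto scl u x"
  shows "x \<in> closure S"
proof (rule ccontr)
  assume "x \<notin> closure S"
  then obtain f where f: "f \<in> dual_space scl" "\<And>s. s \<in> S \<Longrightarrow> f s = 0" "f x \<noteq> 0"
    using dual_space_separates_subspace S by blast
  then have "(\<lambda>k. 0) \<longlonglongrightarrow> f x" using u by (auto simp: weakly_tendsto_def)
  then show False using f(3) LIMSEQ_const_iff by metis
qed

text \<open>A one-element spanning set puts \<open>edim\<close> into its finite case and bounds the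
  dimension by its cardinality.\<close>

lemma edim_le_oneI:
  assumes "span {y} = UNIV"
  shows "edim scl \<le> 1"
proof -
  have "dim UNIV \<le> card {y}" using assms by (intro dim_le_card) auto
  moreover have "\<exists>B. finite B \<and> span B = UNIV" using assms by (intro exI[of _ "{y}"]) auto
  ultimately show ?thesis by (simp add: edim_def one_enat_def)
qed

lemma power_bounded_funpow_norm_le:
  assumes T: "bounded_linear_operator scl T" and "power_bounded T"
  obtains M where "M > 0" "\<And>n x. norm ((T ^^ n) x) \<le> M * norm x"
proof -
  obtain M where M: "\<And>n. onorm (T ^^ n) \<le> M"
    using assms(2) by (auto simp: power_bounded_def bdd_above_def)
  \<comment> \<open>The maximum with 1 makes the bound positive, so that it can serve as a
    divisor.\<close>
  have "norm ((T ^^ n) x) \<le> max M 1 * norm x" for n x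
  proof -
    have "norm ((T ^^ n) x) \<le> onorm (T ^^ n) * norm x"
      using bounded_linear_operator_funpow[OF T] by (intro onorm) (simp add: bounded_linear_operator_def)
    also have "\<dots> \<le> max M 1 * norm x" using M[of n] by (intro mult_right_mono) auto
    finally show ?thesis .
  qed
  then show ?thesis using that[of "max M 1"] by simp
qed

end

section \<open>Weak quasistability from power boundedness and supercyclicity\<close>

theorem corollary4p3:
  fixes scl :: "'f::real_or_complex_field \<Rightarrow> 'a::real_normed_vector \<Rightarrow> 'a"
    and T :: "'a \<Rightarrow> 'a"
  assumes "normed_space_over scl"
    and "separable_space (euclidean :: 'a topology)"
    and "edim scl > 1"
    and "bounded_linear_operator scl T"
    and "power_bounded T"
    and "weakly_l_sequentially_supercyclic scl T"
  shows "weakly_quasistable scl T"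
proof (rule ccontr)
  interpret normed_space_over scl by fact
  note T = assms(4)
  note Tn = bounded_linear_operator_funpow[OF T]
  note Tadd = bounded_linear_operator_add[OF T] and Tscale = bounded_linear_operator_scale[OF T]
  obtain y where "y \<noteq> 0" and y: "weak_limit_set scl (projective_orbit scl T y) = UNIV"
    using assms(6)
    by (auto simp: weakly_l_sequentially_supercyclic_def
        weakly_l_sequentially_supercyclic_vector_def)
  have orbit: "\<exists>\<alpha> n. weakly_tendsto scl (\<lambda>k. scl (\<alpha> k) ((T ^^ n k) y)) x" for x
  proof -
    have "x \<in> weak_limit_set scl (projective_orbit scl T y)" by (simp add: y)
    then obtain u where u: "\<And>k. u k \<in> projective_orbit scl T y" "weakly_tendsto scl u x"
      by (auto simp: weak_limit_set_def)
    from u(1) have "\<forall>k. \<exists>\<alpha> n. u k = scl \<alpha> ((T ^^ n) y)"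
      by (auto simp: projective_orbit_def)
    then obtain \<alpha> n where "\<And>k. u k = scl (\<alpha> k) ((T ^^ n k) y)" by metis
    then have "u = (\<lambda>k. scl (\<alpha> k) ((T ^^ n k) y))" by auto
    then show ?thesis using u(2) by blast
  qed
  obtain M where M: "M > 0" "\<And>n x. norm ((T ^^ n) x) \<le> M * norm x"
    using power_bounded_funpow_norm_le[OF T assms(5)] by blast
  \<comment> \<open>The projective orbit lies in \<open>S\<close>, so every vector is a weak limit
    of elements of \<open>S\<close> and hence in its norm closure.\<close>
  define S where "S = span (range (\<lambda>m. (T ^^ m) y))"
  have "subspace S" by (simp add: S_def)
  have dense: "x \<in> closure S" for x
  proof -
    obtain \<alpha> n where "weakly_tendsto scl (\<lambda>k. scl (\<alpha> k) ((T ^^ n k) y)) x" using orbit by blast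
    moreover have "\<And>k. scl (\<alpha> k) ((T ^^ n k) y) \<in> S"
      unfolding S_def by (intro span_scale span_base) auto
    ultimately show ?thesis by (intro weakly_tendsto_in_closure[OF \<open>subspace S\<close>])
  qed

  \<comment> \<open>A functional bounded away from zero along an orbit\<close>
  assume "\<not> weakly_quasistable scl T"
  then obtain f x0 where f: "f \<in> dual_space scl"
    and "liminf (\<lambda>n. ereal (norm (f ((T ^^ n) x0)))) \<noteq> 0"
    by (auto simp: weakly_quasistable_def)
  moreover have "0 \<le> liminf (\<lambda>n. ereal (norm (f ((T ^^ n) x0))))"
    by (rule Liminf_bounded) simp
  ultimately have "0 < liminf (\<lambda>n. ereal (norm (f ((T ^^ n) x0))))" by simp
  then obtain d where d: "0 < ereal d" "ereal d < liminf (\<lambda>n. ereal (norm (f ((T ^^ n) x0))))"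
    using ereal_dense2 by blast
  then obtain N where N: "\<And>n. n \<ge> N \<Longrightarrow> d < norm (f ((T ^^ n) x0))"
    using less_LiminfD[OF d(2)] by (auto simp: eventually_sequentially)
  have "d > 0" using d by simp
  have bf: "bounded_linear f" using f by (simp add: dual_space_def)
  obtain K where K: "K > 0" "\<And>x. norm (f x) \<le> norm x * K"
    using bounded_linear.pos_bounded[OF bf] by blast
  \<comment> \<open>Starting at the \<open>N\<close>-th iterate makes the lower bound
    \<open>d\<close> hold for all powers, not only eventually.\<close>
  let ?z = "(T ^^ N) x0"
  \<comment> \<open>With this tolerance, passing from \<open>?z\<close> to \<open>x\<close> changes
    the value of \<open>f\<close> after any power of \<open>T\<close> by at most
    \<open>d / 2\<close>.\<close>
  have "d / (2 * K * M) > 0" using \<open>d > 0\<close> K M by simp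
  then obtain x where "x \<in> S" and x: "dist x ?z < d / (2 * K * M)"
    using dense[of ?z] closure_approachable by blast
  have fx: "d / 2 \<le> norm (f ((T ^^ n) x))" for n
  proof -
    have "norm (f ((T ^^ n) (?z - x))) \<le> norm ((T ^^ n) (?z - x)) * K" by (rule K)
    also have "\<dots> \<le> M * norm (?z - x) * K" using M K by (intro mult_right_mono) auto
    also have "\<dots> \<le> d / 2"
      using x M K by (simp add: dist_norm norm_minus_commute field_simps)
    finally have "norm (f ((T ^^ n) (?z - x))) \<le> d / 2" .
    moreover have "f ((T ^^ n) (?z - x)) = f ((T ^^ n) ?z) - f ((T ^^ n) x)"
      using dual_space_diff[OF dual_space_comp[OF f Tn]] .
    moreover have "(T ^^ n) ?z = (T ^^ (n + N)) x0" by (simp add: funpow_add)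
    ultimately show ?thesis
      using N[of "n + N"] norm_triangle_ineq2[of "f ((T ^^ n) ?z)" "f ((T ^^ n) x)"] by simp
  qed
  have fx0: "f x \<noteq> 0" using fx[of 0] \<open>d > 0\<close> by auto

  \<comment> \<open>An operator commuting with \<open>T\<close>, and the decay of the
    scalars\<close>
  define c where "c = f (T x) / f x"
  define P where "P = (\<lambda>v. T v - scl c v)"
  have P_add: "P (v + w) = P v + P w" for v w
    by (simp add: P_def Tadd scale_right_distrib)
  have P_scale: "P (scl a v) = scl a (P v)" for a v
    by (simp add: P_def Tscale scale_right_diff_distrib mult.commute)
  have P_Tn: "P ((T ^^ m) v) = (T ^^ m) (P v)" for m v
  proof (induction m)
    case (Suc m)
    have "P (T w) = T (P w)" for w
      using Tscale Tadd[of "T w - scl c w" "scl c w"] by (simp add: P_def algebra_simps)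
    with Suc show ?case by simp
  qed simp
  have fPx: "f (P x) = 0"
    using fx0 by (simp add: P_def c_def dual_space_diff[OF f] dual_space_scale[OF f])

  obtain \<alpha> n where lim: "weakly_tendsto scl (\<lambda>k. scl (\<alpha> k) ((T ^^ n k) y)) (P y)"
    using orbit by blast
  \<comment> \<open>\<open>P\<close> and the powers of \<open>T\<close> commute, so \<open>\<alpha> k\<close> times
    the \<open>n k\<close>-th power of \<open>T\<close> tends weakly to \<open>P\<close> on the whole span of the orbit.\<close>
  have lim_S: "(\<lambda>k. \<alpha> k * g ((T ^^ n k) v)) \<longlonglongrightarrow> g (P v)" if "v \<in> S" and g: "g \<in> dual_space scl" for v g
    using that(1) unfolding S_def
  proof (induction rule: span_induct_alt)
    case base
    then show ?case
      using P_scale[of 0 0] dual_space_zero[OF g] dual_space_zero[OF dual_space_comp[OF g Tn]] by simp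
  next
    case (step a v w)
    from step(1) obtain m where v: "v = (T ^^ m) y" by blast
    have comm: "(T ^^ n k) ((T ^^ m) y) = (T ^^ m) ((T ^^ n k) y)" for k
      by (metis add.commute comp_apply funpow_add)
    \<comment> \<open>Testing the weak convergence at \<open>y\<close> with \<open>g\<close>
      composed with this power of \<open>T\<close> gives the convergence at the orbit vector
      \<open>v\<close>.\<close>
    have gm: "(\<lambda>v. g ((T ^^ m) v)) \<in> dual_space scl" using dual_space_comp[OF g Tn] .
    have "(\<lambda>k. \<alpha> k * g ((T ^^ n k) v)) \<longlonglongrightarrow> g (P v)"
      using lim gm unfolding weakly_tendsto_def v
      by (fastforce simp: comm P_Tn dual_space_scale[OF gm])
    then have "(\<lambda>k. a * (\<alpha> k * g ((T ^^ n k) v)) + \<alpha> k * g ((T ^^ n k) w)) \<longlonglongrightarrow> a * g (P v) + g (P w)"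
      using step(2) by (intro tendsto_intros)
    moreover have "a * g (P v) + g (P w) = g (P (scl a v + w))"
      by (simp add: P_add P_scale dual_space_add[OF g] dual_space_scale[OF g])
    moreover have "a * (\<alpha> k * g ((T ^^ n k) v)) + \<alpha> k * g ((T ^^ n k) w)
        = \<alpha> k * g ((T ^^ n k) (scl a v + w))" for k
      by (simp add: dual_space_add[OF dual_space_comp[OF g Tn]]
          dual_space_scale[OF dual_space_comp[OF g Tn]] algebra_simps)
    ultimately show ?case by simp
  qed
  have "(\<lambda>k. \<alpha> k * f ((T ^^ n k) x)) \<longlonglongrightarrow> 0" using lim_S[OF \<open>x \<in> S\<close> f] fPx by simp
  \<comment> \<open>By \<open>fx\<close> the factor at \<open>\<alpha> k\<close> has norm at least
    \<open>d / 2\<close>, so these products multiplied by \<open>2 / d\<close> dominate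
    \<open>norm (\<alpha> k)\<close>.\<close>
  have "(\<lambda>k. norm (\<alpha> k * f ((T ^^ n k) x)) * (2 / d)) \<longlonglongrightarrow> 0"
    using tendsto_mult_left_zero[OF tendsto_norm_zero[OF \<open>(\<lambda>k. \<alpha> k * f ((T ^^ n k) x)) \<longlonglongrightarrow> 0\<close>]] .
  then have \<alpha>: "\<alpha> \<longlonglongrightarrow> 0"
  proof (rule Lim_null_comparison[rotated])
    have "norm (\<alpha> k) \<le> norm (\<alpha> k * f ((T ^^ n k) x)) * (2 / d)" for k
      using mult_left_mono[OF fx[of "n k"], of "norm (\<alpha> k)"] \<open>d > 0\<close>
      by (simp add: norm_mult field_simps)
    then show "\<forall>\<^sub>F k in sequentially. norm (\<alpha> k) \<le> norm (\<alpha> k * f ((T ^^ n k) x)) * (2 / d)"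
      by simp
  qed
  \<comment> \<open>Power boundedness keeps \<open>g ((T ^^ n k) y)\<close> bounded, so its product
    with \<open>\<alpha> k\<close> tends to zero; by \<open>lim_S\<close> the same product tends to
    \<open>g (P y)\<close>.\<close>
  have "g (P y) = 0" if g: "g \<in> dual_space scl" for g
  proof -
    have "y \<in> S" unfolding S_def by (rule span_base) (auto intro: range_eqI[of _ _ 0])
    have "bounded_linear g" using g by (simp add: dual_space_def)
    then obtain L where L: "L > 0" "\<And>v. norm (g v) \<le> norm v * L"
      using bounded_linear.pos_bounded by blast
    have "(\<lambda>k. \<alpha> k * g ((T ^^ n k) y)) \<longlonglongrightarrow> 0"
    proof (rule Lim_null_comparison)
      show "(\<lambda>k. norm (\<alpha> k) * (M * norm y * L)) \<longlonglongrightarrow> 0"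
        using tendsto_mult_left_zero[OF tendsto_norm_zero[OF \<alpha>]] .
      have "norm (g ((T ^^ n k) y)) \<le> M * norm y * L" for k
        using L M(2)[of "n k" y] by (meson less_imp_le mult_right_mono order_trans)
      then show "\<forall>\<^sub>F k in sequentially. norm (\<alpha> k * g ((T ^^ n k) y)) \<le> norm (\<alpha> k) * (M * norm y * L)"
        by (simp add: norm_mult mult_left_mono)
    qed
    then show ?thesis using lim_S[OF \<open>y \<in> S\<close> g] LIMSEQ_unique by blast
  qed
  then have "P y = 0" by (rule dual_space_eq_zeroI)
  then have Ty: "T y = scl c y" by (simp add: P_def)
  have Tny: "(T ^^ m) y = scl (c ^ m) y" for m
    by (induction m) (simp_all add: Ty Tscale mult.commute)

  \<comment> \<open>Collapse to dimension at most one\<close>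
  obtain g where g: "g \<in> dual_space scl" "g y \<noteq> 0" using \<open>y \<noteq> 0\<close> dual_space_eq_zeroI by blast
  \<comment> \<open>All approximants of \<open>v\<close> are now multiples of \<open>y\<close>.
    Testing with \<open>g\<close> shows that their coefficients converge to
    \<open>g v / g y\<close>, and all other functionals then agree on \<open>v\<close> and this
    multiple of \<open>y\<close>.\<close>
  have "v = scl (g v / g y) y" for v
  proof -
    obtain \<beta> m where "weakly_tendsto scl (\<lambda>k. scl (\<beta> k) ((T ^^ m k) y)) v" using orbit by blast
    then have *: "(\<lambda>k. \<beta> k * c ^ m k * h y) \<longlonglongrightarrow> h v" if "h \<in> dual_space scl" for h
      using that by (fastforce simp: weakly_tendsto_def Tny dual_space_scale[OF that])
    have "(\<lambda>k. \<beta> k * c ^ m k * g y / g y) \<longlonglongrightarrow> g v / g y"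
      using *[OF g(1)] g(2) by (intro tendsto_intros)
    then have **: "(\<lambda>k. \<beta> k * c ^ m k) \<longlonglongrightarrow> g v / g y" using g(2) by simp
    have "h (v - scl (g v / g y) y) = 0" if h: "h \<in> dual_space scl" for h
      using LIMSEQ_unique[OF *[OF h] tendsto_mult_right[OF **, of "h y"]]
      by (simp add: dual_space_diff[OF h] dual_space_scale[OF h])
    then have "v - scl (g v / g y) y = 0" by (rule dual_space_eq_zeroI)
    then show ?thesis by simp
  qed
  then have "span {y} = UNIV" by (metis UNIV_eq_I insertI1 span_base span_scale)
  from edim_le_oneI[OF this] show False using assms(3) by simp
qed

end
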